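(* For any finite simple graph $G$ we have \[\chi_f(G)\ge 1+\max\left\{\frac{s^+(G)}{s^-(G)},\frac{s^-(G)}{s^+(G)}\right\}.\]
   Context: Eigenvalues of a graph are the eigenvalues of its adjacency matrix. Writing $\lambda_1\ge \lambda_2\ge\cdots$ for the eigenvalues of $G$ (with multiplicity), $s^+(G)=\sum_{i:\lambda_i>0}\lambda_i^2$ and $s^-(G)=\sum_{j:\lambda_j<0}\lambda_j^2$. A homomorphism $G\to H$ is a map $\phi:V(G)\to V(H)$ with $\phi(u)\phi(v)\in E(H)$ whenever $uv\in E(G)$. The Kneser graph $K_{n;k}$ has as vertices the $k$-subsets of an $n$-element set, two being adjacent iff they are disjoint. The fractional chromatic number is $\chi_f(G)=\inf n/k$, the infimum over all pairs $(n,k)$ such that there is a homomorphism from $G$ to $K_{n;k}$. *)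

theory Defs
  imports
    Complex_Main
    "HOL-Computational_Algebra.Polynomial"
    "Graph_Theory.Pair_Digraph"
    "Jordan_Normal_Form.Char_Poly"
begin

text \<open>
  A finite simple graph is a \<open>pair_graph\<close>: a finite loop-free digraph without parallel arcs whose
  arc relation is symmetric, an edge \<open>uv\<close> being the pair of arcs \<open>(u, v)\<close> and \<open>(v, u)\<close>.
\<close>

definition adj_matrix :: "'a list \<Rightarrow> 'a pair_pre_digraph \<Rightarrow> real mat" where
  "adj_matrix vs G =
     mat (length vs) (length vs) (\<lambda>(i, j). if (vs ! i, vs ! j) \<in> parcs G then 1 else 0)"

text \<open>
  The rows and columns of the adjacency matrix are ordered by an arbitrary enumeration of the
  vertices; \<open>graph_eigenvalues_eq\<close> below shows that the choice is immaterial.  All eigenvalues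
  of this symmetric matrix are real, so the real roots of its characteristic polynomial, with
  their multiplicities, are the full spectrum.
\<close>

definition graph_eigenvalues :: "'a pair_pre_digraph \<Rightarrow> real multiset" where
  "graph_eigenvalues G =
     proots (char_poly (adj_matrix (SOME vs. distinct vs \<and> set vs = pverts G) G))"

definition s_plus :: "'a pair_pre_digraph \<Rightarrow> real" where
  "s_plus G = (\<Sum>x\<in>#filter_mset (\<lambda>x. x > 0) (graph_eigenvalues G). x\<^sup>2)"

definition s_minus :: "'a pair_pre_digraph \<Rightarrow> real" where
  "s_minus G = (\<Sum>x\<in>#filter_mset (\<lambda>x. x < 0) (graph_eigenvalues G). x\<^sup>2)"

definition graph_hom :: "'a pair_pre_digraph \<Rightarrow> 'b pair_pre_digraph \<Rightarrow> ('a \<Rightarrow> 'b) \<Rightarrow> bool" where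
  "graph_hom G H \<phi> \<longleftrightarrow>
     (\<forall>v\<in>pverts G. \<phi> v \<in> pverts H) \<and> (\<forall>(u, v)\<in>parcs G. (\<phi> u, \<phi> v) \<in> parcs H)"

definition kneser_graph :: "nat \<Rightarrow> nat \<Rightarrow> nat set pair_pre_digraph" where
  "kneser_graph n k =
     (let V = {A. A \<subseteq> {..<n} \<and> card A = k}
      in \<lparr>pverts = V, parcs = {(A, B). A \<in> V \<and> B \<in> V \<and> A \<inter> B = {}}\<rparr>)"

text \<open>
  The restriction \<open>k \<ge> 1\<close> makes \<open>n/k\<close> meaningful; it also excludes the empty set as a vertex
  of the Kneser graph, which would be disjoint from itself.
\<close>

definition fractional_chromatic_number :: "'a pair_pre_digraph \<Rightarrow> real" where
  "fractional_chromatic_number G =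
     Inf {real n / real k | n k. k \<ge> 1 \<and> (\<exists>\<phi>. graph_hom G (kneser_graph n k) \<phi>)}"

lemma char_poly_adj_matrix_enum:
  assumes "distinct vs" "distinct ws" "set vs = set ws"
  shows "char_poly (adj_matrix vs G) = char_poly (adj_matrix ws G)"
proof -
  define n where "n = length vs"
  have lw: "length ws = n"
    using assms by (metis distinct_card n_def)
  define perm :: "'a list \<Rightarrow> 'a list \<Rightarrow> real mat" where
    "perm xs ys = mat n n (\<lambda>(i, j). if xs ! i = ys ! j then 1 else 0)" for xs ys
  have L: "(\<Sum>k<n. (if x = ys ! k then 1 else 0) * f (ys ! k)) = (f x :: real)"
    if ys: "length ys = n" "distinct ys" "x \<in> set ys" for ys :: "'a list" and x and f :: "'a \<Rightarrow> real"
  proof -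
    obtain l where l: "l < n" "x = ys ! l" using ys by (auto simp: in_set_conv_nth)
    have "(if x = ys ! k then 1 else 0) * f (ys ! k) = (if k = l then f x else 0)" if "k < n" for k
    proof -
      have "ys ! l = ys ! k \<longleftrightarrow> l = k"
        using nth_eq_iff_index_eq[OF ys(2)] ys(1) \<open>k < n\<close> \<open>l < n\<close> by blast
      then show ?thesis unfolding l(2) by (cases "k = l") simp_all
    qed
    then have "(\<Sum>k<n. (if x = ys ! k then 1 else 0) * f (ys ! k)) = (\<Sum>k<n. if k = l then f x else 0)"
      by (intro sum.cong) auto
    then show ?thesis using l by simp
  qed
  have PQ: "perm xs ys * perm ys xs = 1\<^sub>m n"
    if "length xs = n" "length ys = n" "distinct xs" "distinct ys" "set xs = set ys" for xs ys
  proof (rule eq_matI)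
    fix i j assume "i < dim_row (1\<^sub>m n :: real mat)" "j < dim_col (1\<^sub>m n :: real mat)"
    then have ij: "i < n" "j < n" by auto
    then have "xs ! i \<in> set ys" using that(1,5) nth_mem[of i xs] by simp
    from L[OF that(2) that(4) this, of "\<lambda>y. if y = xs ! j then 1 else 0"]
    show "(perm xs ys * perm ys xs) $$ (i, j) = 1\<^sub>m n $$ (i, j)"
      using ij that by (simp add: perm_def scalar_prod_def nth_eq_iff_index_eq lessThan_atLeast0)
  qed (auto simp: perm_def)
  have PA: "perm vs ws * adj_matrix ws G =
      mat n n (\<lambda>(i, j). if (vs ! i, ws ! j) \<in> parcs G then 1 else 0)"
  proof (rule eq_matI, goal_cases)
    case (1 i j)
    then have ij: "i < n" "j < n" by auto
    then have "vs ! i \<in> set ws" using assms(3) nth_mem[of _ vs] n_def by blast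
    from L[OF lw assms(2) this, of "\<lambda>y. if (y, ws ! j) \<in> parcs G then 1 else 0"]
    show ?case
      using ij lw by (simp add: perm_def adj_matrix_def scalar_prod_def lessThan_atLeast0)
  qed (auto simp: perm_def adj_matrix_def lw)
  have PAQ: "adj_matrix vs G = perm vs ws * adj_matrix ws G * perm ws vs"
    unfolding PA
  proof (rule eq_matI, goal_cases)
    case (1 i j)
    then have ij: "i < n" "j < n" by (auto simp: perm_def)
    then have "vs ! j \<in> set ws" using assms(3) nth_mem[of _ vs] n_def by blast
    note L[OF lw assms(2) this, of "\<lambda>y. if (vs ! i, y) \<in> parcs G then 1 else 0"]
    moreover have "(\<Sum>k<n. (if (vs ! i, ws ! k) \<in> parcs G then 1 else 0) *
          (if ws ! k = vs ! j then 1 else 0)) =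
        (\<Sum>k<n. (if vs ! j = ws ! k then 1 else 0) *
          (if (vs ! i, ws ! k) \<in> parcs G then 1 else (0 :: real)))"
      by (intro sum.cong) auto
    ultimately show ?case
      using ij n_def
      by (simp add: perm_def adj_matrix_def scalar_prod_def lessThan_atLeast0)
  qed (auto simp: perm_def adj_matrix_def n_def)
  have "similar_mat_wit (adj_matrix vs G) (adj_matrix ws G) (perm vs ws) (perm ws vs)"
    using PQ[OF n_def[symmetric] lw assms] PQ[OF lw n_def[symmetric] assms(2,1) assms(3)[symmetric]] PAQ
    by (rule similar_mat_witI) (simp_all add: perm_def adj_matrix_def lw n_def[symmetric])
  then have "similar_mat (adj_matrix vs G) (adj_matrix ws G)"
    unfolding similar_mat_def by blast
  then show ?thesis by (rule char_poly_similar)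
qed

lemma graph_eigenvalues_eq:
  assumes "distinct vs" "set vs = pverts G"
  shows "graph_eigenvalues G = proots (char_poly (adj_matrix vs G))"
proof -
  let ?ws = "SOME vs. distinct vs \<and> set vs = pverts G"
  have "distinct ?ws \<and> set ?ws = pverts G"
    by (rule someI[of _ vs]) (use assms in auto)
  then show ?thesis
    unfolding graph_eigenvalues_def using assms char_poly_adj_matrix_enum[of ?ws vs G] by simp
qed

end

theory Submission
  imports
    Defs
    "HOL-Analysis.Convex"
    "Jordan_Normal_Form.Spectral_Radius"
begin

text \<open>
  Write the adjacency matrix as \<open>A = P - Q\<close> with \<open>P\<close>, \<open>Q\<close> its positive and negative spectral parts,
  so that \<open>s\<^sup>+\<close>, \<open>s\<^sup>-\<close> are the sums of the squared entries of \<open>P\<close>, \<open>Q\<close>, and \<open>P\<close>, \<open>Q\<close> are orthogonal.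
  Off the edges \<open>P\<close> and \<open>Q\<close> agree; let \<open>t\<close> be the common sum of their squared entries there.  Given a
  homomorphism \<open>\<phi>\<close> into the Kneser graph with parameters \<open>n\<close>, \<open>k\<close>, the matrix
  \<open>card (\<phi> u \<inter> \<phi> v) - k\<^sup>2 / n\<close> is a Gram matrix, hence by the Schur product theorem its entrywise product
  with the square of \<open>P\<close> has nonnegative entry sum.  As \<open>card (\<phi> u \<inter> \<phi> v)\<close> vanishes on edges and is at
  most \<open>k\<close> elsewhere, this gives \<open>s\<^sup>+ \<le> (n / k) t\<close>, and likewise \<open>s\<^sup>- \<le> (n / k) t\<close>.  On the edges the
  inner product of \<open>P\<close> and \<open>Q\<close> is \<open>- t\<close>, so Cauchy-Schwarz yields
  \<open>t\<^sup>2 \<le> (s\<^sup>+ - t) (s\<^sup>- - t)\<close>, that is \<open>t (s\<^sup>+ + s\<^sup>-) \<le> s\<^sup>+ s\<^sup>-\<close>.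
\<close>

section \<open>Spectral theorem for real symmetric matrices\<close>

text \<open>A complex eigenvalue \<open>e\<close> exists by algebraic closedness. Pairing the
  eigenvector with its own conjugate gives \<open>e * N\<close>, with \<open>N\<close> its squared
  norm; as \<open>A\<close> is real and symmetric this number is its own conjugate, so
  \<open>e\<close> is real.\<close>

lemma symmetric_real_mat_has_eigenvalue:
  fixes A :: "real mat"
  assumes A: "A \<in> carrier_mat n n" and n: "n > 0"
    and sym: "\<And>i j. i < n \<Longrightarrow> j < n \<Longrightarrow> A $$ (i, j) = A $$ (j, i)"
  shows "\<exists>e. eigenvalue A e"
proof -
  let ?A = "map_mat complex_of_real A"
  have cA: "?A \<in> carrier_mat n n" using A by simp
  obtain e where "eigenvalue ?A e" using spectrum_non_empty[OF cA n] by (auto simp: spectrum_def)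
  then obtain x where x: "x \<in> carrier_vec n" "x \<noteq> 0\<^sub>v n" "?A *\<^sub>v x = e \<cdot>\<^sub>v x"
    using cA by (auto simp: eigenvalue_def eigenvector_def)
  have row: "(\<Sum>j<n. of_real (A $$ (i, j)) * x $ j) = e * x $ i" if "i < n" for i
  proof -
    have "(?A *\<^sub>v x) $ i = (\<Sum>j<n. of_real (A $$ (i, j)) * x $ j)"
      using that x(1) A by (auto simp: scalar_prod_def lessThan_atLeast0 intro!: sum.cong)
    then show ?thesis using x that by simp
  qed
  define N where "N = (\<Sum>i<n. cnj (x $ i) * x $ i)"
  have N: "N = of_real (\<Sum>i<n. (cmod (x $ i))\<^sup>2)"
    unfolding N_def of_real_sum by (intro sum.cong refl) (metis complex_norm_square mult.commute)
  obtain i where "i < n" "x $ i \<noteq> 0" using x(1,2) by (metis carrier_vecD eq_vecI index_zero_vec)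
  then have "(\<Sum>i<n. (cmod (x $ i))\<^sup>2) > 0" by (intro sum_pos2[of _ i]) auto
  then have N0: "N \<noteq> 0" unfolding N by (simp del: of_real_sum)
  have eN: "e * N = (\<Sum>i<n. \<Sum>j<n. of_real (A $$ (i, j)) * cnj (x $ i) * x $ j)"
    unfolding N_def sum_distrib_left
  proof (intro sum.cong refl)
    fix i assume "i \<in> {..<n}"
    then have "e * (cnj (x $ i) * x $ i) = cnj (x $ i) * (\<Sum>j<n. of_real (A $$ (i, j)) * x $ j)"
      using row[of i] by simp
    then show "e * (cnj (x $ i) * x $ i) = (\<Sum>j<n. of_real (A $$ (i, j)) * cnj (x $ i) * x $ j)"
      by (simp add: sum_distrib_left mult_ac)
  qed
  have "cnj (e * N) = (\<Sum>i<n. \<Sum>j<n. of_real (A $$ (i, j)) * x $ i * cnj (x $ j))"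
    unfolding eN by simp
  also have "\<dots> = (\<Sum>j<n. \<Sum>i<n. of_real (A $$ (i, j)) * x $ i * cnj (x $ j))"
    by (rule sum.swap)
  also have "\<dots> = e * N"
    unfolding eN using sym by (intro sum.cong refl) (auto simp: mult_ac)
  finally have "cnj e * N = e * N" by (simp add: N)
  then have "cnj e = e" using N0 by simp
  then have e: "e = of_real (Re e)" by (metis Reals_cnj_iff of_real_Re)
  \<comment> \<open>The characteristic polynomial commutes with the embedding of the reals, so the
    real root descends to \<open>A\<close>.\<close>
  have "poly (char_poly ?A) (of_real (Re e)) = 0"
    using \<open>eigenvalue ?A e\<close> e eigenvalue_root_char_poly[OF cA] by simp
  then have "poly (char_poly A) (Re e) = 0"
    unfolding of_real_hom.char_poly_hom[OF A] by simp
  then show ?thesis using eigenvalue_root_char_poly[OF A] by blast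
qed

text \<open>
  The witness is the Householder reflection exchanging \<open>v\<close> with the first unit vector; if these
  coincide, the factor \<open>2 / 0 = 0\<close> turns it into the identity.
\<close>

lemma orthogonal_mat_with_first_col:
  fixes v :: "real vec"
  assumes v: "v \<in> carrier_vec n" and n: "n > 0" and unit: "(\<Sum>i<n. (v $ i)\<^sup>2) = 1"
  obtains U where "U \<in> carrier_mat n n" "transpose_mat U = U" "U * U = 1\<^sub>m n" "col U 0 = v"
proof -
  define w where "w i = v $ i - (if i = 0 then 1 else 0)" for i
  define d where "d = (\<Sum>i<n. (w i)\<^sup>2)"
  define c where "c = 2 / d"
  define U where "U = mat n n (\<lambda>(i, j). (if i = j then 1 else 0) - c * w i * w j)"
  \<comment> \<open>Holds also for \<open>d = 0\<close>, where \<open>c = 0\<close>; it makes the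
    terms in \<open>w i * w j\<close> cancel in \<open>U * U\<close>.\<close>
  have ccd: "c * c * d = 2 * c" unfolding c_def by simp
  have "d = (\<Sum>i<n. (v $ i)\<^sup>2 + (if i = 0 then 1 - 2 * v $ i else 0))"
    unfolding d_def w_def by (intro sum.cong refl) (auto simp: power2_eq_square algebra_simps)
  then have d: "d = 2 - 2 * v $ 0" using n unit by (simp add: sum.distrib)
  \<comment> \<open>Column 0 of \<open>U\<close> is thus the first unit vector plus
    \<open>w\<close>, which is \<open>v\<close>.\<close>
  have cw: "c * w i * w 0 = - w i" if "i < n" for i
  proof (cases "d = 0")
    case True
    then have "w i = 0" using that unfolding d_def by (simp add: sum_nonneg_eq_0_iff)
    then show ?thesis by simp
  next
    case False
    have "w 0 = - d / 2" unfolding w_def d by simp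
    with False show ?thesis unfolding c_def by simp
  qed
  have carr: "U \<in> carrier_mat n n" unfolding U_def by simp
  moreover have "transpose_mat U = U"
    by (rule eq_matI) (auto simp: U_def mult_ac)
  moreover have "U * U = 1\<^sub>m n"
  proof (rule eq_matI)
    fix i j assume "i < dim_row (1\<^sub>m n :: real mat)" "j < dim_col (1\<^sub>m n :: real mat)"
    then have ij: "i < n" "j < n" by auto
    have "(U * U) $$ (i, j) = (\<Sum>k<n. ((if i = k then 1 else 0) - c * w i * w k) *
        ((if k = j then 1 else 0) - c * w k * w j))"
      using ij by (simp add: U_def scalar_prod_def lessThan_atLeast0)
    also have "\<dots> = (\<Sum>k<n. (if k = i then (if i = j then 1 else 0) - c * w i * w j else 0)
        - (if k = j then c * w i * w j else 0) + c * c * w i * w j * (w k)\<^sup>2)"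
      by (intro sum.cong refl) (auto simp: power2_eq_square algebra_simps)
    also have "\<dots> = (if i = j then 1 else 0) - 2 * c * w i * w j + c * c * w i * w j * d"
      unfolding sum.distrib sum_subtractf d_def sum_distrib_left using ij by simp
    also have "c * c * w i * w j * d = 2 * c * w i * w j"
      using ccd by (metis mult.assoc mult.commute)
    finally show "(U * U) $$ (i, j) = 1\<^sub>m n $$ (i, j)" using ij by simp
  qed (use carr in auto)
  moreover have "col U 0 = v"
  proof (rule eq_vecI)
    fix i assume "i < dim_vec v"
    then have "i < n" using v by simp
    then show "col U 0 $ i = v $ i" using n cw[of i] by (auto simp: U_def w_def)
  qed (use v in \<open>auto simp: U_def\<close>)
  ultimately show thesis by (rule that)
qed

text \<open>Deflation: conjugating by a reflection whose first column is a unit eigenvector splits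
  off a block of size 1, and the induction hypothesis diagonalizes the remaining symmetric
  block.\<close>

lemma symmetric_real_mat_orthogonal_diagonalization:
  fixes A :: "real mat"
  assumes "A \<in> carrier_mat n n" "transpose_mat A = A"
  shows "\<exists>Q D. Q \<in> carrier_mat n n \<and> D \<in> carrier_mat n n \<and> diagonal_mat D \<and>
    transpose_mat Q * Q = 1\<^sub>m n \<and> A = Q * D * transpose_mat Q"
  using assms
proof (induction n arbitrary: A)
  case 0
  then show ?case by (intro exI[of _ A]) (auto simp: diagonal_mat_def)
next
  case (Suc n)
  have A: "A \<in> carrier_mat (Suc n) (Suc n)" and At: "transpose_mat A = A" by fact+
  have "A $$ (i, j) = A $$ (j, i)" if "i < Suc n" "j < Suc n" for i j
    using At A that by (metis carrier_matD index_transpose_mat(1))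
  then obtain e where "eigenvalue A e"
    using symmetric_real_mat_has_eigenvalue[OF A] by auto
  then obtain x where x: "x \<in> carrier_vec (Suc n)" "x \<noteq> 0\<^sub>v (Suc n)" "A *\<^sub>v x = e \<cdot>\<^sub>v x"
    using A by (auto simp: eigenvalue_def eigenvector_def)
  define r where "r = sqrt (\<Sum>i<Suc n. (x $ i)\<^sup>2)"
  define v where "v = (1 / r) \<cdot>\<^sub>v x"
  obtain i where "i < Suc n" "x $ i \<noteq> 0" using x(1,2) by (metis carrier_vecD eq_vecI index_zero_vec)
  then have "(\<Sum>i<Suc n. (x $ i)\<^sup>2) > 0" by (intro sum_pos2[of _ i]) auto
  then have r: "r > 0" "r\<^sup>2 = (\<Sum>i<Suc n. (x $ i)\<^sup>2)" unfolding r_def by simp_all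
  have v: "v \<in> carrier_vec (Suc n)" unfolding v_def using x by simp
  have "A *\<^sub>v v = (1 / r) \<cdot>\<^sub>v (e \<cdot>\<^sub>v x)" unfolding v_def using A x by (simp add: mult_mat_vec)
  then have Av: "A *\<^sub>v v = e \<cdot>\<^sub>v v" unfolding v_def by (simp add: smult_smult_assoc mult.commute)
  have "(\<Sum>i<Suc n. (v $ i)\<^sup>2) = (\<Sum>i<Suc n. (x $ i)\<^sup>2 / r\<^sup>2)"
    unfolding v_def using x(1) by (intro sum.cong refl) (auto simp: power_divide)
  also have "\<dots> = 1" unfolding sum_divide_distrib[symmetric] r(2)[symmetric] using r(1) by simp
  finally obtain U where U: "U \<in> carrier_mat (Suc n) (Suc n)" "transpose_mat U = U"
      "U * U = 1\<^sub>m (Suc n)" "col U 0 = v"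
    using orthogonal_mat_with_first_col[OF v] by auto
  note ac = assoc_mult_mat[of _ "Suc n" "Suc n" _ "Suc n" _ "Suc n"]
  define B where "B = U * A * U"
  have B: "B \<in> carrier_mat (Suc n) (Suc n)" using U A by (simp add: B_def)
  have UAc: "U * A \<in> carrier_mat (Suc n) (Suc n)" using U A by simp
  have Bt: "transpose_mat B = B"
    unfolding B_def using U A At UAc
    by (simp add: transpose_mult[of _ "Suc n" "Suc n" _ "Suc n"] ac)
  have UBU: "U * B * U = A"
  proof -
    have "U * B * U = (U * U) * A * (U * U)"
      unfolding B_def using U(1) A by (simp add: ac)
    then show ?thesis using U(3) A by simp
  qed
  have "B = U * (A * U)" unfolding B_def using assoc_mult_mat[OF U(1) A U(1)] .
  then have "col B 0 = U *\<^sub>v col (A * U) 0"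
    using col_mult2[OF U(1) mult_carrier_mat[OF A U(1)], of 0] by simp
  also have "col (A * U) 0 = A *\<^sub>v v" using col_mult2[OF A U(1), of 0] U(4) by simp
  also have "U *\<^sub>v (A *\<^sub>v v) = e \<cdot>\<^sub>v (U *\<^sub>v col U 0)" unfolding Av using U v by (simp add: mult_mat_vec)
  also have "U *\<^sub>v col U 0 = col (U * U) 0" using col_mult2[OF U(1) U(1), of 0] by simp
  \<comment> \<open>As \<open>v\<close> is column 0 of \<open>U\<close> and \<open>U * U\<close> is
    the identity, \<open>B\<close> has the first unit vector as eigenvector; symmetry then clears
    the first row as well.\<close>
  finally have colB: "col B 0 = e \<cdot>\<^sub>v unit_vec (Suc n) 0" unfolding U(3) by simp
  have B0: "B $$ (i, 0) = (if i = 0 then e else 0)" if "i < Suc n" for i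
    using arg_cong[OF colB, of "\<lambda>v. v $ i"] B that by simp
  have B0': "B $$ (0, i) = (if i = 0 then e else 0)" if "i < Suc n" for i
    using B0[OF that] Bt B that by (metis carrier_matD index_transpose_mat(1) zero_less_Suc)
  define A' where "A' = mat n n (\<lambda>(i, j). B $$ (Suc i, Suc j))"
  let ?E = "mat 1 1 (\<lambda>_. e) :: real mat"
  have A': "A' \<in> carrier_mat n n" by (simp add: A'_def)
  have "transpose_mat A' = A'"
    unfolding A'_def using B Bt by (intro eq_matI) (auto, metis Suc_less_eq carrier_matD index_transpose_mat(1))
  from Suc.IH[OF A' this] obtain Q D where Q: "Q \<in> carrier_mat n n" and D: "D \<in> carrier_mat n n"
    and dD: "diagonal_mat D" and QQ: "transpose_mat Q * Q = 1\<^sub>m n"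
    and A'Q: "A' = Q * D * transpose_mat Q" by blast
  have B4: "B = four_block_mat ?E (0\<^sub>m 1 n) (0\<^sub>m n 1) A'"
    by (rule eq_matI) (use B B0 B0' in \<open>auto simp: A'_def\<close>)
  define R where "R = four_block_mat (1\<^sub>m 1) (0\<^sub>m 1 n) (0\<^sub>m n 1) Q"
  define D2 where "D2 = four_block_mat ?E (0\<^sub>m 1 n) (0\<^sub>m n 1) D"
  have R: "R \<in> carrier_mat (Suc n) (Suc n)" and D2: "D2 \<in> carrier_mat (Suc n) (Suc n)"
    unfolding R_def D2_def using Q D by auto
  have Rt: "transpose_mat R = four_block_mat (1\<^sub>m 1) (0\<^sub>m 1 n) (0\<^sub>m n 1) (transpose_mat Q)"
    unfolding R_def using Q by (subst transpose_four_block_mat[of _ 1 1 _ n _ n]) auto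
  have "R * D2 = four_block_mat ?E (0\<^sub>m 1 n) (0\<^sub>m n 1) (Q * D)"
    unfolding R_def D2_def using Q D
    by (subst mult_four_block_mat[of _ 1 1 _ n _ n _ _ 1 _ n]) auto
  then have "R * D2 * transpose_mat R = four_block_mat ?E (0\<^sub>m 1 n) (0\<^sub>m n 1) (Q * D * transpose_mat Q)"
    unfolding Rt using Q D
    by (simp, subst mult_four_block_mat[of _ 1 1 _ n _ n _ _ 1 _ n]) auto
  then have BR: "R * D2 * transpose_mat R = B" unfolding B4 A'Q .
  have "transpose_mat R * R = four_block_mat (1\<^sub>m 1) (0\<^sub>m 1 n) (0\<^sub>m n 1) (1\<^sub>m n)"
    unfolding Rt unfolding R_def using Q QQ
    by (subst mult_four_block_mat[of _ 1 1 _ n _ n _ _ 1 _ n]) auto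
  then have RR: "transpose_mat R * R = 1\<^sub>m (Suc n)" by simp
  have dD2: "diagonal_mat D2"
    using dD D unfolding diagonal_mat_def D2_def by auto
  have Rtc: "transpose_mat R \<in> carrier_mat (Suc n) (Suc n)" using R by simp
  have URt: "transpose_mat (U * R) = transpose_mat R * U"
    using U R by (simp add: transpose_mult[of _ "Suc n" "Suc n" _ "Suc n"])
  have "transpose_mat (U * R) * (U * R) = transpose_mat R * (U * U) * R"
    unfolding URt using U(1) R Rtc by (simp add: ac)
  also have "\<dots> = 1\<^sub>m (Suc n)" unfolding U(3) using R Rtc RR by simp
  finally have 1: "transpose_mat (U * R) * (U * R) = 1\<^sub>m (Suc n)" .
  have 2: "A = (U * R) * D2 * transpose_mat (U * R)"
    unfolding URt UBU[symmetric] BR[symmetric] using U(1) R Rtc D2 by (simp add: ac)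
  show ?case
    using 1 2 dD2 D2 U(1) R by (intro exI[of _ "U * R"] exI[of _ D2]) auto
qed

lemma proots_prod_linear_factors:
  "proots (\<Prod>a\<leftarrow>as. [:- a, 1 :: 'a :: idom:]) = mset as"
proof (induction as)
  case (Cons a as)
  have "(\<Prod>a\<leftarrow>a # as. [:- a, 1:]) \<noteq> 0"
    by (subst prod_list_zero_iff) auto
  with Cons show ?case by (simp add: proots_mult del: mult_pCons_left)
qed simp

text \<open>Coordinate form of the diagonalization: \<open>q k\<close> is column \<open>k\<close> of
  \<open>Q\<close> and \<open>\<mu> k\<close> a diagonal entry of \<open>D\<close>. Similarity to
  \<open>D\<close> makes multiplicities agree with those of the characteristic polynomial.\<close>

lemma symmetric_real_mat_spectral_decomposition:
  fixes A :: "real mat"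
  assumes A: "A \<in> carrier_mat n n" and sym: "transpose_mat A = A"
  obtains q :: "nat \<Rightarrow> nat \<Rightarrow> real" and \<mu> :: "nat \<Rightarrow> real"
  where "\<And>k l. k < n \<Longrightarrow> l < n \<Longrightarrow> (\<Sum>i<n. q k i * q l i) = (if k = l then 1 else 0)"
    and "\<And>i j. i < n \<Longrightarrow> j < n \<Longrightarrow> A $$ (i, j) = (\<Sum>k<n. \<mu> k * q k i * q k j)"
    and "proots (char_poly A) = image_mset \<mu> (mset_set {..<n})"
proof -
  obtain Q D where Q: "Q \<in> carrier_mat n n" and D: "D \<in> carrier_mat n n"
    and dD: "diagonal_mat D" and QQ: "transpose_mat Q * Q = 1\<^sub>m n"
    and AQ: "A = Q * D * transpose_mat Q"
    using symmetric_real_mat_orthogonal_diagonalization[OF A sym] by blast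
  show thesis
  proof (rule that[of "\<lambda>k i. Q $$ (i, k)" "\<lambda>k. D $$ (k, k)"])
    fix k l assume kl: "k < n" "l < n"
    have "(transpose_mat Q * Q) $$ (k, l) = (\<Sum>i<n. Q $$ (i, k) * Q $$ (i, l))"
      using kl Q by (simp add: scalar_prod_def lessThan_atLeast0)
    then show "(\<Sum>i<n. Q $$ (i, k) * Q $$ (i, l)) = (if k = l then 1 else 0)"
      unfolding QQ using kl by simp
  next
    fix i j assume ij: "i < n" "j < n"
    have QD: "(Q * D) $$ (i, k) = Q $$ (i, k) * D $$ (k, k)" if "k < n" for k
    proof -
      have "(Q * D) $$ (i, k) = (\<Sum>l<n. Q $$ (i, l) * D $$ (l, k))"
        using ij that Q D by (simp add: scalar_prod_def lessThan_atLeast0)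
      also have "\<dots> = (\<Sum>l<n. if l = k then Q $$ (i, k) * D $$ (k, k) else 0)"
        using dD D that by (intro sum.cong refl) (auto simp: diagonal_mat_def)
      finally show ?thesis using that by simp
    qed
    have "(R * transpose_mat Q) $$ (i, j) = (\<Sum>k<n. R $$ (i, k) * Q $$ (j, k))"
      if "R \<in> carrier_mat n n" for R :: "real mat"
      using that ij Q by (simp add: scalar_prod_def lessThan_atLeast0)
    from this[OF mult_carrier_mat[OF Q D]]
    have "A $$ (i, j) = (\<Sum>k<n. (Q * D) $$ (i, k) * Q $$ (j, k))"
      unfolding AQ .
    then show "A $$ (i, j) = (\<Sum>k<n. D $$ (k, k) * Q $$ (i, k) * Q $$ (j, k))"
      using QD by (simp add: mult_ac)
  next
    have Qt: "transpose_mat Q \<in> carrier_mat n n" using Q by simp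
    have "similar_mat_wit A D Q (transpose_mat Q)"
      by (rule similar_mat_witI[OF mat_mult_left_right_inverse[OF Qt Q QQ] QQ AQ A D Q Qt])
    then have "char_poly A = char_poly D"
      using char_poly_similar unfolding similar_mat_def by blast
    also have "\<dots> = (\<Prod>a\<leftarrow>diag_mat D. [:- a, 1:])"
      using dD D by (intro char_poly_upper_triangular) (auto simp: diagonal_mat_def)
    finally have "proots (char_poly A) = mset (diag_mat D)"
      by (simp only: proots_prod_linear_factors)
    also have "\<dots> = image_mset (\<lambda>k. D $$ (k, k)) (mset_set {..<n})"
      using D by (simp add: diag_mat_def lessThan_atLeast0)
    finally show "proots (char_poly A) = image_mset (\<lambda>k. D $$ (k, k)) (mset_set {..<n})" .
  qed
qed

section \<open>Entrywise products of spectral forms\<close>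

text \<open>For rank-one matrices the sum over \<open>i\<close> and \<open>j\<close> factors into
  two equal sums, hence the square; bilinearity does the rest.\<close>

lemma sum_mult_spectral_forms:
  fixes f :: "'i \<Rightarrow> 'v \<Rightarrow> real" and g :: "'j \<Rightarrow> 'v \<Rightarrow> real"
  shows "(\<Sum>i\<in>V. \<Sum>j\<in>V. (\<Sum>k\<in>K. a k * f k i * f k j) * (\<Sum>l\<in>L. b l * g l i * g l j)) =
    (\<Sum>k\<in>K. \<Sum>l\<in>L. a k * b l * (\<Sum>i\<in>V. f k i * g l i)\<^sup>2)"
proof -
  let ?t = "\<lambda>i j k l. a k * b l * ((f k i * g l i) * (f k j * g l j))"
  have "(\<Sum>i\<in>V. \<Sum>j\<in>V. (\<Sum>k\<in>K. a k * f k i * f k j) * (\<Sum>l\<in>L. b l * g l i * g l j)) =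
    (\<Sum>i\<in>V. \<Sum>j\<in>V. \<Sum>k\<in>K. \<Sum>l\<in>L. ?t i j k l)"
    by (intro sum.cong refl) (simp add: sum_product mult_ac)
  also have "\<dots> = (\<Sum>i\<in>V. \<Sum>k\<in>K. \<Sum>j\<in>V. \<Sum>l\<in>L. ?t i j k l)"
    by (intro sum.cong refl sum.swap)
  also have "\<dots> = (\<Sum>k\<in>K. \<Sum>i\<in>V. \<Sum>j\<in>V. \<Sum>l\<in>L. ?t i j k l)"
    by (rule sum.swap)
  also have "\<dots> = (\<Sum>k\<in>K. \<Sum>i\<in>V. \<Sum>l\<in>L. \<Sum>j\<in>V. ?t i j k l)"
    by (intro sum.cong refl sum.swap)
  also have "\<dots> = (\<Sum>k\<in>K. \<Sum>l\<in>L. \<Sum>i\<in>V. \<Sum>j\<in>V. ?t i j k l)"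
    by (intro sum.cong refl sum.swap)
  also have "\<dots> = (\<Sum>k\<in>K. \<Sum>l\<in>L. a k * b l * (\<Sum>i\<in>V. f k i * g l i)\<^sup>2)"
    unfolding power2_eq_square sum_product unfolding sum_distrib_left ..
  finally show ?thesis .
qed

text \<open>One factor of the square times the Gram matrix is again a nonnegative combination of
  rank-one matrices, indexed by \<open>K \<times> L\<close>. Pairing it with the other factor leaves
  nonnegative weights times squares.\<close>

lemma schur_product_sum_nonneg:
  fixes q :: "'i \<Rightarrow> 'v \<Rightarrow> real" and y :: "'l \<Rightarrow> 'v \<Rightarrow> real"
  assumes "\<And>k. k \<in> K \<Longrightarrow> 0 \<le> a k"
  shows "0 \<le> (\<Sum>i\<in>V. \<Sum>j\<in>V. (\<Sum>k\<in>K. a k * q k i * q k j)\<^sup>2 * (\<Sum>l\<in>L. y l i * y l j))"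
proof -
  have *: "(\<Sum>k\<in>K. a k * q k i * q k j) * (\<Sum>l\<in>L. y l i * y l j) =
      (\<Sum>p\<in>K \<times> L. a (fst p) * (q (fst p) i * y (snd p) i) * (q (fst p) j * y (snd p) j))" for i j
    unfolding sum_product sum.cartesian_product by (simp add: case_prod_unfold mult_ac)
  have "(\<Sum>i\<in>V. \<Sum>j\<in>V. (\<Sum>k\<in>K. a k * q k i * q k j)\<^sup>2 * (\<Sum>l\<in>L. y l i * y l j)) =
    (\<Sum>i\<in>V. \<Sum>j\<in>V. (\<Sum>k\<in>K. a k * q k i * q k j) *
      ((\<Sum>k\<in>K. a k * q k i * q k j) * (\<Sum>l\<in>L. y l i * y l j)))"
    by (simp only: power2_eq_square mult.assoc)
  also have "\<dots> \<ge> 0"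
    unfolding * sum_mult_spectral_forms
    by (intro sum_nonneg mult_nonneg_nonneg) (use assms in auto)
  finally show ?thesis .
qed

text \<open>With \<open>a = b\<close> this turns sums of squared entries into sums of squared
  eigenvalues; with coefficients of disjoint support it gives orthogonality.\<close>

lemma sum_mult_spectral_forms_orthonormal:
  fixes q :: "'i \<Rightarrow> 'v \<Rightarrow> real"
  assumes "finite K"
    and orth: "\<And>k l. k \<in> K \<Longrightarrow> l \<in> K \<Longrightarrow> (\<Sum>i\<in>V. q k i * q l i) = (if k = l then 1 else 0)"
  shows "(\<Sum>i\<in>V. \<Sum>j\<in>V. (\<Sum>k\<in>K. a k * q k i * q k j) * (\<Sum>l\<in>K. b l * q l i * q l j)) =
    (\<Sum>k\<in>K. a k * b k)"
proof -
  have "(\<Sum>k\<in>K. \<Sum>l\<in>K. a k * b l * (\<Sum>i\<in>V. q k i * q l i)\<^sup>2) =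
      (\<Sum>k\<in>K. \<Sum>l\<in>K. if k = l then a k * b l else 0)"
    by (intro sum.cong refl) (simp add: orth)
  then show ?thesis
    unfolding sum_mult_spectral_forms using \<open>finite K\<close> by simp
qed

section \<open>From families of \<open>k\<close>-subsets to the ratio bound\<close>

text \<open>Exhibits the Gram vectors: indicators of the sets, centred at their mean
  \<open>k / n\<close>. Centring is what produces the term \<open>k\<^sup>2 / n\<close>, and with it
  the factor \<open>n / k\<close> in the final bound.\<close>

lemma sum_indicator_deviations:
  fixes A B :: "nat set"
  assumes "A \<subseteq> {..<n}" "B \<subseteq> {..<n}" "card A = k" "card B = k" "n > 0"
  shows "(\<Sum>l<n. (of_bool (l \<in> A) - real k / real n) * (of_bool (l \<in> B) - real k / real n)) =
    real (card (A \<inter> B)) - (real k)\<^sup>2 / real n"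
proof -
  have c: "(\<Sum>l<n. of_bool (l \<in> S)) = real (card S)" if "S \<subseteq> {..<n}" for S
    using that by (simp add: Int_absorb1)
  have "(\<Sum>l<n. (of_bool (l \<in> A) - real k / real n) * (of_bool (l \<in> B) - real k / real n)) =
    (\<Sum>l<n. of_bool (l \<in> A \<inter> B) - real k / real n * of_bool (l \<in> B)
        - real k / real n * of_bool (l \<in> A) + (real k / real n)\<^sup>2)"
    by (intro sum.cong refl) (auto simp: algebra_simps power2_eq_square)
  also have "\<dots> = real (card (A \<inter> B)) - real k / real n * real (card B)
      - real k / real n * real (card A) + real n * (real k / real n)\<^sup>2"
    unfolding sum.distrib sum_subtractf sum_distrib_left[symmetric]
    using assms(1,2) c[of "A \<inter> B"] c[of A] c[of B] by (simp add: le_infI1)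
  also have "\<dots> = real (card (A \<inter> B)) - (real k)\<^sup>2 / real n"
    using assms by (simp add: field_simps power2_eq_square)
  finally show ?thesis .
qed

lemma ratio_bound_of_common_part:
  fixes s m t c :: real
  assumes "0 \<le> s" "0 \<le> m" "1 \<le> c" "s \<le> c * t" "m \<le> c * t" "t\<^sup>2 \<le> (s - t) * (m - t)"
  shows "1 + max (s / m) (m / s) \<le> c"
proof (cases "s = 0 \<or> m = 0")
  \<comment> \<open>Division by zero yields 0, so both ratios vanish and \<open>1 \<le> c\<close>
    remains.\<close>
  case True
  then show ?thesis using assms by auto
next
  case False
  then have pos: "s > 0" "m > 0" using assms by auto
  \<comment> \<open>The two occurrences of the square of \<open>t\<close> cancel. Multiplying the
    bounds on \<open>s\<close> and \<open>m\<close> by \<open>s + m\<close> then eliminates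
    \<open>t\<close>.\<close>
  have t: "t * (s + m) \<le> s * m"
    using assms(6) by (simp add: algebra_simps power2_eq_square)
  have ct: "c * t * (s + m) \<le> c * (s * m)"
    using mult_left_mono[OF t, of c] assms(3) by (simp add: mult.assoc)
  have "s * (s + m) \<le> s * (c * m)"
    using order_trans[OF mult_right_mono[OF assms(4), of "s + m"] ct] pos by (simp add: mult_ac)
  then have 1: "s + m \<le> c * m" using pos by simp
  have "m * (s + m) \<le> m * (c * s)"
    using order_trans[OF mult_right_mono[OF assms(5), of "s + m"] ct] pos by (simp add: mult_ac)
  then have 2: "s + m \<le> c * s" using pos by simp
  show ?thesis using 1 2 pos by (auto simp: field_simps max_def)
qed

text \<open>The argument freed from graphs: the spectral form and the sets \<open>\<phi> i\<close>
  are linked only through \<open>E\<close>, off which the form vanishes and on which the sets are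
  disjoint. The maxima with 0 select the eigenvalues of one sign while keeping the index set
  \<open>K\<close>.\<close>

lemma kneser_ratio_bound:
  fixes q :: "'i \<Rightarrow> 'v \<Rightarrow> real" and \<mu> :: "'i \<Rightarrow> real" and \<phi> :: "'v \<Rightarrow> nat set"
  assumes fin: "finite K" "finite V" and ne: "V \<noteq> {}"
    and orth: "\<And>k l. k \<in> K \<Longrightarrow> l \<in> K \<Longrightarrow> (\<Sum>i\<in>V. q k i * q l i) = (if k = l then 1 else 0)"
    and spec: "\<And>i j. i \<in> V \<Longrightarrow> j \<in> V \<Longrightarrow> (i, j) \<notin> E \<Longrightarrow> (\<Sum>k\<in>K. \<mu> k * q k i * q k j) = 0"
    and \<phi>: "\<And>i. i \<in> V \<Longrightarrow> \<phi> i \<subseteq> {..<n} \<and> card (\<phi> i) = r" and r: "r \<ge> 1"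
    and disj: "\<And>i j. i \<in> V \<Longrightarrow> j \<in> V \<Longrightarrow> (i, j) \<in> E \<Longrightarrow> \<phi> i \<inter> \<phi> j = {}"
  defines "s \<equiv> \<Sum>k\<in>K. (max (\<mu> k) 0)\<^sup>2" and "m \<equiv> \<Sum>k\<in>K. (max (- \<mu> k) 0)\<^sup>2"
  shows "1 + max (s / m) (m / s) \<le> real n / real r"
proof -
  define M where "M a p = (\<Sum>k\<in>K. a k * q k (fst p) * q k (snd p))" for a p
  define N where "N = V \<times> V - E"
  define F where "F = V \<times> V \<inter> E"
  \<comment> \<open>\<open>P\<close> and \<open>Q\<close> share the eigenvectors \<open>q\<close>,
    so their difference is the form with coefficients \<open>\<mu>\<close>, which vanishes on
    \<open>N\<close>.\<close>
  define P where "P = M (\<lambda>k. max (\<mu> k) 0)"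
  define Q where "Q = M (\<lambda>k. max (- \<mu> k) 0)"
  define t where "t = (\<Sum>p\<in>N. (P p)\<^sup>2)"
  have finN: "finite N" and finF: "finite F" using fin by (auto simp: N_def F_def)
  have split: "sum h (V \<times> V) = sum h N + sum h F" for h :: "'v \<times> 'v \<Rightarrow> real"
    unfolding N_def F_def using fin
    by (metis Diff_Diff_Int Diff_subset add.commute finite_SigmaI sum.subset_diff)
  \<comment> \<open>Together with \<open>r \<ge> 1\<close> this gives \<open>n > 0\<close> for the
    divisions and \<open>1 \<le> n / r\<close> for the last step.\<close>
  have rn: "r \<le> n"
  proof -
    obtain i where "i \<in> V" using ne by blast
    with \<phi>[of i] show ?thesis using card_mono[of "{..<n}" "\<phi> i"] by simp
  qed
  have inner: "(\<Sum>p\<in>V \<times> V. M a p * M b p) = (\<Sum>k\<in>K. a k * b k)" for a b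
    using sum_mult_spectral_forms_orthonormal[OF fin(1) orth, where a = a and b = b]
    by (simp add: M_def sum.cartesian_product case_prod_unfold)
  have PQ: "P p = Q p" if "p \<in> N" for p
  proof -
    have "P p - Q p = (\<Sum>k\<in>K. \<mu> k * q k (fst p) * q k (snd p))"
      unfolding P_def Q_def M_def sum_subtractf[symmetric]
      by (intro sum.cong refl) (auto simp: max_def algebra_simps)
    then show ?thesis using spec[of "fst p" "snd p"] that by (auto simp: N_def)
  qed
  \<comment> \<open>Kept general in \<open>a\<close> so as to serve both \<open>P\<close> and
    \<open>Q\<close>.\<close>
  have bound: "(\<Sum>k\<in>K. (a k)\<^sup>2) \<le> real n / real r * (\<Sum>p\<in>N. (M a p)\<^sup>2)"
    if "\<And>k. k \<in> K \<Longrightarrow> 0 \<le> a k" for a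
  proof -
    let ?W = "\<lambda>p. real (card (\<phi> (fst p) \<inter> \<phi> (snd p)))"
    have "0 \<le> (\<Sum>i\<in>V. \<Sum>j\<in>V. (\<Sum>k\<in>K. a k * q k i * q k j)\<^sup>2 *
        (\<Sum>l<n. (of_bool (l \<in> \<phi> i) - real r / real n) * (of_bool (l \<in> \<phi> j) - real r / real n)))"
      by (rule schur_product_sum_nonneg) (rule that)
    also have "\<dots> = (\<Sum>i\<in>V. \<Sum>j\<in>V. (\<Sum>k\<in>K. a k * q k i * q k j)\<^sup>2 *
        (real (card (\<phi> i \<inter> \<phi> j)) - (real r)\<^sup>2 / real n))"
      using \<phi> rn r by (intro sum.cong refl) (simp add: sum_indicator_deviations)
    also have "\<dots> = (\<Sum>p\<in>V \<times> V. (M a p)\<^sup>2 * (?W p - (real r)\<^sup>2 / real n))"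
      by (simp add: M_def sum.cartesian_product case_prod_unfold)
    also have "\<dots> = (\<Sum>p\<in>V \<times> V. (M a p)\<^sup>2 * ?W p) - (real r)\<^sup>2 / real n * (\<Sum>k\<in>K. (a k)\<^sup>2)"
      using inner[of a a] unfolding right_diff_distrib sum_subtractf sum_distrib_right[symmetric]
      by (simp add: power2_eq_square)
    \<comment> \<open>Disjointness on \<open>E\<close> kills the contribution of
      \<open>F\<close>.\<close>
    also have "(\<Sum>p\<in>V \<times> V. (M a p)\<^sup>2 * ?W p) = (\<Sum>p\<in>N. (M a p)\<^sup>2 * ?W p)"
      unfolding split using disj by (auto simp: F_def intro!: sum.neutral)
    also have "\<dots> \<le> (\<Sum>p\<in>N. (M a p)\<^sup>2 * real r)"
    proof (intro sum_mono mult_left_mono)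
      fix p assume "p \<in> N"
      then have "fst p \<in> V" by (auto simp: N_def)
      from \<phi>[OF this] have "card (\<phi> (fst p) \<inter> \<phi> (snd p)) \<le> r"
        using card_mono[of "\<phi> (fst p)" "\<phi> (fst p) \<inter> \<phi> (snd p)"] finite_subset by auto
      then show "?W p \<le> real r" by simp
    qed simp
    finally have "(real r)\<^sup>2 / real n * (\<Sum>k\<in>K. (a k)\<^sup>2) \<le> real r * (\<Sum>p\<in>N. (M a p)\<^sup>2)"
      by (simp add: sum_distrib_left mult.commute)
    then show ?thesis using r rn by (simp add: field_simps power2_eq_square)
  qed
  have tQ: "t = (\<Sum>p\<in>N. (Q p)\<^sup>2)" unfolding t_def using PQ by simp
  have tPQ: "t = (\<Sum>p\<in>N. P p * Q p)" unfolding t_def using PQ by (simp add: power2_eq_square)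
  \<comment> \<open>For each \<open>k\<close> one of the two maxima is 0.\<close>
  have "(\<Sum>p\<in>V \<times> V. P p * Q p) = 0"
    unfolding P_def Q_def inner by (intro sum.neutral) (auto simp: max_def)
  then have e1: "(\<Sum>p\<in>F. P p * Q p) = - t" using tPQ unfolding split by simp
  have e2: "(\<Sum>p\<in>F. (P p)\<^sup>2) = s - t"
    using inner[of "\<lambda>k. max (\<mu> k) 0" "\<lambda>k. max (\<mu> k) 0"] unfolding split t_def s_def P_def
    by (simp add: power2_eq_square)
  have e3: "(\<Sum>p\<in>F. (Q p)\<^sup>2) = m - t"
    using inner[of "\<lambda>k. max (- \<mu> k) 0" "\<lambda>k. max (- \<mu> k) 0"] unfolding split tQ m_def Q_def
    by (simp add: power2_eq_square)
  have "t\<^sup>2 \<le> (s - t) * (m - t)"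
    using Cauchy_Schwarz_ineq_sum[of P Q F] unfolding e1 e2 e3 by simp
  moreover have "s \<le> real n / real r * t"
    unfolding s_def t_def P_def by (rule bound) simp
  moreover have "m \<le> real n / real r * t"
    unfolding m_def tQ Q_def by (rule bound) simp
  ultimately show ?thesis
    using r rn by (intro ratio_bound_of_common_part[where t = t]) (auto simp: s_def m_def intro: sum_nonneg)
qed

section \<open>Application to graphs\<close>

lemma s_plus_eq_sum:
  assumes "graph_eigenvalues G = image_mset \<mu> (mset_set {..<n :: nat})"
  shows "s_plus G = (\<Sum>k<n. (max (\<mu> k) 0)\<^sup>2)"
proof -
  have "s_plus G = (\<Sum>k\<in>{k \<in> {..<n}. \<mu> k > 0}. (\<mu> k)\<^sup>2)"
    unfolding s_plus_def assms by (simp add: filter_mset_image_mset filter_mset_mset_set sum_unfold_sum_mset multiset.map_comp o_def)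
  also have "\<dots> = (\<Sum>k<n. (max (\<mu> k) 0)\<^sup>2)"
    by (rule sum.mono_neutral_cong_left) (auto simp: max_def)
  finally show ?thesis .
qed

lemma s_minus_eq_sum:
  assumes "graph_eigenvalues G = image_mset \<mu> (mset_set {..<n :: nat})"
  shows "s_minus G = (\<Sum>k<n. (max (- \<mu> k) 0)\<^sup>2)"
proof -
  have "s_minus G = (\<Sum>k\<in>{k \<in> {..<n}. \<mu> k < 0}. (\<mu> k)\<^sup>2)"
    unfolding s_minus_def assms by (simp add: filter_mset_image_mset filter_mset_mset_set sum_unfold_sum_mset multiset.map_comp o_def)
  also have "\<dots> = (\<Sum>k<n. (max (- \<mu> k) 0)\<^sup>2)"
    by (rule sum.mono_neutral_cong_left) (auto simp: max_def)
  finally show ?thesis .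
qed

text \<open>Giving every vertex its own colour works because arcs join distinct vertices. This
  ensures that the infimum is over a nonempty set.\<close>

lemma graph_hom_kneser_1_exists:
  assumes "pair_graph G"
  shows "\<exists>n \<phi>. graph_hom G (kneser_graph n 1) \<phi>"
proof -
  interpret pair_graph G by fact
  obtain f :: "'a \<Rightarrow> nat" and n where f: "f ` pverts G = {i. i < n}" "inj_on f (pverts G)"
    using finite_imp_nat_seg_image_inj_on[OF pair_finite_verts]
      finite_imp_inj_to_nat_seg[OF pair_finite_verts] by blast
  have "graph_hom G (kneser_graph n 1) (\<lambda>v. {f v})"
    unfolding graph_hom_def kneser_graph_def Let_def
  proof (intro conjI ballI, goal_cases)
    case (1 v)
    then show ?case using f by auto
  next
    case (2 p)
    obtain u v where p: "p = (u, v)" by fastforce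
    with 2 have "u \<in> pverts G" "v \<in> pverts G" "u \<noteq> v" using in_arcsD1 in_arcsD2 pair_no_loops[of p] by auto
    then show ?case using f unfolding p by (auto dest: inj_onD)
  qed
  then show ?thesis by blast
qed

text \<open>Transports the abstract bound along an enumeration of the vertices: positions in
  \<open>vs\<close> serve as \<open>V\<close>, and \<open>E\<close> is the arc relation pulled back
  to them.\<close>

lemma graph_hom_kneser_bound:
  assumes G: "pair_graph G" and ne: "pverts G \<noteq> {}"
    and r: "r \<ge> 1" and hom: "graph_hom G (kneser_graph n r) \<phi>"
  shows "1 + max (s_plus G / s_minus G) (s_minus G / s_plus G) \<le> real n / real r"
proof -
  interpret pair_graph G by fact
  obtain vs where vs: "distinct vs" "set vs = pverts G"
    using finite_distinct_list[OF pair_finite_verts] by blast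
  let ?d = "length vs"
  have A: "adj_matrix vs G \<in> carrier_mat ?d ?d" by (simp add: adj_matrix_def)
  have "transpose_mat (adj_matrix vs G) = adj_matrix vs G"
    by (rule eq_matI) (auto simp: adj_matrix_def arcs_symmetric)
  then obtain q \<mu> where
    orth: "\<And>k l. k < ?d \<Longrightarrow> l < ?d \<Longrightarrow> (\<Sum>i<?d. q k i * q l i) = (if k = l then 1 else (0 :: real))"
    and dec: "\<And>i j. i < ?d \<Longrightarrow> j < ?d \<Longrightarrow> adj_matrix vs G $$ (i, j) = (\<Sum>k<?d. \<mu> k * q k i * q k j)"
    and ev: "proots (char_poly (adj_matrix vs G)) = image_mset \<mu> (mset_set {..<?d})"
    by (rule symmetric_real_mat_spectral_decomposition[OF A]) blast
  define E where "E = {(i, j). (vs ! i, vs ! j) \<in> parcs G}"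
  have ge: "graph_eigenvalues G = image_mset \<mu> (mset_set {..<?d})"
    using graph_eigenvalues_eq[OF vs] ev by simp
  show ?thesis
    unfolding s_plus_eq_sum[OF ge] s_minus_eq_sum[OF ge]
  proof (rule kneser_ratio_bound[where V = "{..<?d}" and E = E and q = q and \<phi> = "\<lambda>i. \<phi> (vs ! i)"])
    show "{..<?d} \<noteq> {}" using ne vs(2) by (auto simp: lessThan_empty_iff)
    show "(\<Sum>k<?d. \<mu> k * q k i * q k j) = 0"
      if "i \<in> {..<?d}" "j \<in> {..<?d}" "(i, j) \<notin> E" for i j
      using dec[of i j] that by (auto simp: adj_matrix_def E_def)
    show "\<phi> (vs ! i) \<subseteq> {..<n} \<and> card (\<phi> (vs ! i)) = r" if "i \<in> {..<?d}" for i
    proof -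
      have "vs ! i \<in> pverts G" using vs that nth_mem by auto
      then show ?thesis using hom unfolding graph_hom_def kneser_graph_def Let_def by auto
    qed
    show "\<phi> (vs ! i) \<inter> \<phi> (vs ! j) = {}" if "(i, j) \<in> E" for i j
      using that hom unfolding graph_hom_def kneser_graph_def Let_def E_def by auto
  qed (use orth r in auto)
qed

theorem theorem1p2:
  fixes G :: "'a pair_pre_digraph"
  assumes "pair_graph G"
    and "pverts G \<noteq> {}"
  shows "fractional_chromatic_number G \<ge>
           1 + max (s_plus G / s_minus G) (s_minus G / s_plus G)"
  unfolding fractional_chromatic_number_def
\<comment> \<open>A lower bound for every ratio passes to the infimum only if some ratio exists,
  since \<open>Inf\<close> of an empty set of reals carries no such guarantee.\<close>
proof (rule cInf_greatest)
  show "{real n / real k | n k. k \<ge> 1 \<and> (\<exists>\<phi>. graph_hom G (kneser_graph n k) \<phi>)} \<noteq> {}"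
    using graph_hom_kneser_1_exists[OF assms(1)] by blast
qed (use graph_hom_kneser_bound[OF assms] in blast)

end
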